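(* Let $X$ be a space with enough arcs and $f\colon X\to Y$ be a surjective continuous map. If the image space $Y$ is metrizable, then $Y$ has enough arcs.
   Context: An arc is a homeomorphic copy of $[0,1]$. A space with enough arcs is a nondegenerate metrizable space $X$ (i.e. one with at least two points) such that for every nonempty proper closed subset $A\subseteq X$ there is an arc in $X$ with one endpoint in $A$ and the other endpoint in $X\setminus A$.
   Formalization: The image space Y is additionally assumed to have at least two points; otherwise the claim fails, e.g. for the constant map from [0,1] onto a one-point space, which is degenerate and so does not have enough arcs. *)

theory Defs
  imports "HOL-Analysis.Analysis"
begin

text \<open>The library constant \<open>arc\<close> concerns parametrized paths in types of class
  \<open>topological_space\<close>; here an arc is a subset of an abstract topological space that is
  homeomorphic to the unit interval, its endpoints being the images of 0 and 1.\<close>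

definition arc_between :: "'a topology \<Rightarrow> 'a set \<Rightarrow> 'a \<Rightarrow> 'a \<Rightarrow> bool" where
  "arc_between X C a b \<longleftrightarrow>
     C \<subseteq> topspace X \<and>
     (\<exists>g. homeomorphic_map (top_of_set {0..1::real}) (subtopology X C) g \<and> g 0 = a \<and> g 1 = b)"

definition nondegenerate_space :: "'a topology \<Rightarrow> bool" where
  "nondegenerate_space X \<longleftrightarrow> (\<exists>x\<in>topspace X. \<exists>y\<in>topspace X. x \<noteq> y)"

definition enough_arcs :: "'a topology \<Rightarrow> bool" where
  "enough_arcs X \<longleftrightarrow>
     nondegenerate_space X \<and> metrizable_space X \<and>
     (\<forall>A. closedin X A \<and> A \<noteq> {} \<and> A \<noteq> topspace X \<longrightarrow>
        (\<exists>C a b. arc_between X C a b \<and> a \<in> A \<and> b \<in> topspace X - A))"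

end

theory Submission
  imports Defs
begin

text \<open>The preimage under \<open>f\<close> of a nonempty proper closed set \<open>A\<close> is again nonempty, proper and
  closed, so some arc of \<open>X\<close> joins it to its complement. The image of that arc under \<open>f\<close> is only
  a path, running from a point of \<open>A\<close> to a point outside \<open>A\<close>, since \<open>f\<close> need not be injective on
  the arc. What makes the proof work is that in a metrizable space any path between two distinct
  points contains an arc with the same endpoints.

  For Banach spaces this is the library theorem \<open>path_contains_arc\<close>. It carries over to an
  arbitrary metric space because the image of a path embeds isometrically into the Banach space of
  bounded continuous functions on the line (\<open>Kuratowski_embedding\<close>): an arc found inside the
  embedded image pulls back to the original space.\<close>

text \<open>A point \<open>x\<close> is sent to the function \<open>\<lambda>t. d x (s t)\<close>. By the triangle inequality
  \<open>d x (s t) - d y (s t)\<close> never exceeds \<open>d x y\<close> in absolute value, and it attains that bound for any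
  \<open>t\<close> with \<open>s t = y\<close>; this is why the points are taken from the range of \<open>s\<close>. Continuity and
  boundedness of \<open>s\<close> put these functions into the Banach space.\<close>

lemma (in Metric_space) Kuratowski_embedding:
  fixes s :: "'i::topological_space \<Rightarrow> 'a"
  assumes cont: "continuous_map euclidean mtopology s" and bdd: "mbounded (range s)"
  obtains \<Phi> :: "'a \<Rightarrow> 'i \<Rightarrow>\<^sub>C real"
  where "\<And>x y. \<lbrakk>x \<in> range s; y \<in> range s\<rbrakk> \<Longrightarrow> dist (\<Phi> x) (\<Phi> y) = d x y"
proof -
  have sM: "s t \<in> M" for t
    using continuous_map_funspace[OF cont] by auto
  have "\<exists>\<phi>. apply_bcontfun \<phi> = (\<lambda>t. d x (s t))" if x: "x \<in> range s" for x
  proof -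
    obtain B where B: "\<And>y z. \<lbrakk>y \<in> range s; z \<in> range s\<rbrakk> \<Longrightarrow> d y z \<le> B"
      using bdd by (auto simp: mbounded_alt)
    have "continuous_map euclidean euclideanreal (\<lambda>t. mdist (metric (M, d)) x (s t))"
      using x sM cont by (intro continuous_map_mdist) (auto simp: mtopology_of)
    then have "continuous_on UNIV (\<lambda>t. d x (s t))"
      by simp
    then have "(\<lambda>t. d x (s t)) \<in> bcontfun"
      using B x by (intro bcontfun_normI[where b = B]) auto
    then show ?thesis
      by (metis bcontfunE)
  qed
  then obtain \<Phi> :: "'a \<Rightarrow> 'i \<Rightarrow>\<^sub>C real"
    where \<Phi>: "\<And>x t. x \<in> range s \<Longrightarrow> apply_bcontfun (\<Phi> x) t = d x (s t)"
    by metis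
  have "dist (\<Phi> x) (\<Phi> y) = d x y" if x: "x \<in> range s" and y: "y \<in> range s" for x y
  proof (rule antisym)
    have xM: "x \<in> M" and yM: "y \<in> M"
      using x y sM by auto
    show "dist (\<Phi> x) (\<Phi> y) \<le> d x y"
    proof (rule dist_bound)
      fix t
      show "dist (\<Phi> x t) (\<Phi> y t) \<le> d x y"
        using triangle[OF xM yM sM[of t]] triangle[OF yM xM sM[of t]] commute[of x y]
        by (simp add: \<Phi> x y dist_real_def abs_le_iff)
    qed
    obtain t where t: "y = s t"
      using y by auto
    have "d x y = dist (\<Phi> x t) (\<Phi> y t)"
      using xM yM by (simp add: \<Phi> x y dist_real_def flip: t)
    also have "\<dots> \<le> dist (\<Phi> x) (\<Phi> y)"
      by (rule dist_bounded)
    finally show "d x y \<le> dist (\<Phi> x) (\<Phi> y)" .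
  qed
  then show thesis
    using that by blast
qed

text \<open>The unit interval is compact, so a continuous injection of it into a Hausdorff space is
  automatically an embedding.\<close>

lemma arc_between_if_injective_path:
  assumes "Hausdorff_space Y" "pathin Y g" "inj_on g {0..1}"
  shows "arc_between Y (g ` {0..1}) (g 0) (g 1)"
proof -
  have "embedding_map (top_of_set {0..1}) Y g"
    using assms by (intro continuous_imp_embedding_map)
      (auto simp: pathin_def compact_space_subtopology)
  moreover have "g ` {0..1} \<subseteq> topspace Y"
    using assms(2) path_image_subset_topspace by blast
  ultimately show ?thesis
    by (auto simp: arc_between_def embedding_map_def)
qed

text \<open>Pulling an arc back along the embedding \<open>\<Phi>\<close> works because the arc stays inside the image of
  the embedded path: there \<open>\<Phi>\<close> has an isometric inverse, whose composite with the arc is again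
  continuous and injective and has the original endpoints.\<close>

lemma metrizable_path_contains_arc:
  assumes "metrizable_space Y" and p: "pathin Y p" and "p 0 \<noteq> p 1"
  shows "\<exists>C \<subseteq> p ` {0..1}. arc_between Y C (p 0) (p 1)"
proof -
  obtain M d where "Metric_space M d" and Y: "Y = Metric_space.mtopology M d"
    using assms(1) by (auto simp: metrizable_space_def)
  then interpret Metric_space M d
    by simp
  \<comment> \<open>The path is extended by constants to the whole line, so that it is defined on a type.\<close>
  define s where "s = p \<circ> (\<lambda>t. max 0 (min 1 t))"
  have "continuous_map euclideanreal (top_of_set {0..1}) (\<lambda>t. max 0 (min 1 t))"
    by (auto simp: continuous_map_in_subtopology intro!: continuous_intros)
  then have cont_s: "continuous_map euclidean mtopology s"
    unfolding s_def using p Y by (auto simp: pathin_def intro: continuous_map_compose)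
  have s_eq: "s t = p t" if "t \<in> {0..1}" for t
    using that by (simp add: s_def)
  have range_s: "range s = p ` {0..1}"
  proof
    show "range s \<subseteq> p ` {0..1}"
      by (auto simp: s_def)
    show "p ` {0..1} \<subseteq> range s"
      using s_eq by (metis image_subsetI rangeI)
  qed
  have "compactin mtopology (p ` {0..1})"
    using compactin_path_image p Y by blast
  then have "mbounded (range s)"
    by (simp add: range_s compactin_imp_mbounded)
  with cont_s obtain \<Phi> :: "'a \<Rightarrow> real \<Rightarrow>\<^sub>C real" where
    iso: "\<And>x y. \<lbrakk>x \<in> p ` {0..1}; y \<in> p ` {0..1}\<rbrakk> \<Longrightarrow> dist (\<Phi> x) (\<Phi> y) = d x y"
    by (metis Kuratowski_embedding range_s)
  have pM: "p t \<in> M" if "t \<in> {0..1}" for t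
    using p Y path_image_subset_topspace that by fastforce
  have inj: "inj_on \<Phi> (p ` {0..1})"
    using iso pM by (intro inj_onI) (metis dist_self imageE zero)
  have "path (\<Phi> \<circ> p)"
    unfolding path_def continuous_on_iff
  proof (intro ballI allI impI)
    fix t e :: real
    assume t: "t \<in> {0..1}" and "e > 0"
    moreover have "continuous_map (top_of_set {0..1}) mtopology p"
      using p by (simp add: pathin_def Y)
    ultimately have "\<exists>U. openin (top_of_set {0..1}) U \<and> t \<in> U \<and> (\<forall>u\<in>U. p u \<in> mball (p t) e)"
      by (simp only: continuous_map_to_metric topspace_euclidean_subtopology)
    then obtain U where "openin (top_of_set {0..1}) U" "t \<in> U" "\<And>u. u \<in> U \<Longrightarrow> p u \<in> mball (p t) e"
      by blast
    then show "\<exists>\<delta>>0. \<forall>u\<in>{0..1}. dist u t < \<delta> \<longrightarrow> dist ((\<Phi> \<circ> p) u) ((\<Phi> \<circ> p) t) < e"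
      using t by (fastforce simp: openin_euclidean_subtopology_iff iso commute)
  qed
  moreover have "(\<Phi> \<circ> p) 0 \<noteq> (\<Phi> \<circ> p) 1"
    using inj \<open>p 0 \<noteq> p 1\<close> by (auto dest: inj_onD)
  ultimately obtain q where q: "arc q" "path_image q \<subseteq> path_image (\<Phi> \<circ> p)"
    "q 0 = \<Phi> (p 0)" "q 1 = \<Phi> (p 1)"
    using path_contains_arc[of "\<Phi> \<circ> p"] unfolding pathstart_def pathfinish_def by auto
  define g where "g = inv_into (p ` {0..1}) \<Phi> \<circ> q"
  have q_in: "q t \<in> \<Phi> ` p ` {0..1}" if "t \<in> {0..1}" for t
    using q(2) that by (auto simp: path_image_def image_comp)
  have g_in: "g t \<in> p ` {0..1}" and \<Phi>_g: "\<Phi> (g t) = q t" if "t \<in> {0..1}" for t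
    using q_in[OF that] by (auto simp: g_def inv_into_into f_inv_into_f)
  have ends: "g 0 = p 0" "g 1 = p 1"
    using q(3,4) inj by (auto simp: g_def)
  have "pathin Y g"
    unfolding pathin_def Y continuous_map_to_metric
  proof (intro ballI allI impI)
    fix t e :: real
    assume "t \<in> topspace (top_of_set {0..1})" and "e > 0"
    then have t: "t \<in> {0..1}"
      by simp
    have "continuous_on {0..1} q"
      using q(1) by (simp add: arc_def path_def)
    then have "openin (top_of_set {0..1}) ({0..1} \<inter> q -` ball (q t) e)"
      by (simp add: continuous_openin_preimage_gen)
    moreover have "g u \<in> mball (g t) e" if "u \<in> {0..1}" "dist (q t) (q u) < e" for u
    proof -
      have "d (g t) (g u) = dist (q t) (q u)"
        using iso g_in \<Phi>_g t that(1) by metis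
      moreover have "g t \<in> M" "g u \<in> M"
        using g_in[OF t] g_in[OF that(1)] pM by auto
      ultimately show ?thesis
        using that(2) by simp
    qed
    ultimately show "\<exists>U. openin (top_of_set {0..1}) U \<and> t \<in> U \<and> (\<forall>u\<in>U. g u \<in> mball (g t) e)"
      using t \<open>e > 0\<close> by (intro exI[of _ "{0..1} \<inter> q -` ball (q t) e"]) auto
  qed
  moreover have "inj_on g {0..1}"
    using q(1) \<Phi>_g unfolding arc_def by (metis inj_on_def)
  ultimately have "arc_between Y (g ` {0..1}) (p 0) (p 1)"
    using arc_between_if_injective_path[of Y g] Hausdorff_space_mtopology Y ends by simp
  then show ?thesis
    using g_in by blast
qed

theorem proposition22:
  fixes X :: "'a topology" and Y :: "'b topology" and f :: "'a \<Rightarrow> 'b"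
  assumes "enough_arcs X"
    and "continuous_map X Y f"
    and "f ` topspace X = topspace Y"
    and "metrizable_space Y"
    and "nondegenerate_space Y"
  shows "enough_arcs Y"
  unfolding enough_arcs_def
proof (intro conjI allI impI)
  fix A
  assume A: "closedin Y A \<and> A \<noteq> {} \<and> A \<noteq> topspace Y"
  define B where "B = {x \<in> topspace X. f x \<in> A}"
  have "closedin X B"
    using A assms(2) by (auto simp: B_def closedin_continuous_map_preimage)
  moreover have "f ` B = A"
    using A assms(3) closedin_subset[of Y A] by (auto simp: B_def image_iff)
  then have "B \<noteq> {}" "B \<noteq> topspace X"
    using A assms(3) by auto
  ultimately obtain C a b where "arc_between X C a b" and ab: "a \<in> B" "b \<in> topspace X - B"
    using assms(1) unfolding enough_arcs_def by blast
  then obtain g where "homeomorphic_map (top_of_set {0..1::real}) (subtopology X C) g"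
    and g: "g 0 = a" "g 1 = b"
    by (auto simp: arc_between_def)
  then have "pathin X g"
    by (auto simp: pathin_def continuous_map_in_subtopology dest: homeomorphic_imp_continuous_map)
  then have "pathin Y (f \<circ> g)"
    using assms(2) by (auto simp: pathin_def intro: continuous_map_compose)
  moreover have ends: "f a \<in> A" "f b \<in> topspace Y - A"
    using ab assms(3) by (auto simp: B_def)
  then have "f a \<noteq> f b"
    by auto
  ultimately have "\<exists>D. arc_between Y D (f a) (f b)"
    using metrizable_path_contains_arc[OF assms(4), of "f \<circ> g"] g by auto
  then show "\<exists>C a b. arc_between Y C a b \<and> a \<in> A \<and> b \<in> topspace Y - A"
    using ends by blast
qed (use assms in auto)

end
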